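(* Let $X_1,X_2,\dots$ be i.i.d. with $X_1\equiv c$ almost surely, where $c>0$ is a constant, and let $\mu=\mathbb{E}[X_1]$. Then for every $k>1$ the inequality $$\mathbb{E}\left[R_b^{\,k}\right]\ \le\ \frac{\mathbb{E}\left[(X_1^+)^{k+1}\right]}{k\,\mu}$$ fails at $b=0$.
   Context: $S_0=0$, $S_n=X_1+\dots+X_n$; for $b\ge0$, $\tau(b)=\inf\{n\ge1:S_n>b\}$ and $R_b=S_{\tau(b)}-b$. $x^+=\max\{x,0\}$. *)

theory Defs
  imports "HOL-Probability.Probability" "HOL-Library.Extended_Nat"
begin

text \<open>The increments of the walk are \<open>X 1, X 2, \<dots>\<close>; the variable \<open>X 0\<close> is never used.\<close>

definition iid :: "'a measure \<Rightarrow> (nat \<Rightarrow> 'a \<Rightarrow> real) \<Rightarrow> bool" where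
  "iid M X \<longleftrightarrow>
     prob_space.indep_vars M (\<lambda>_. borel) X {1..} \<and>
     (\<forall>i\<ge>1. distr M borel (X i) = distr M borel (X 1))"

definition walk :: "(nat \<Rightarrow> 'a \<Rightarrow> real) \<Rightarrow> nat \<Rightarrow> 'a \<Rightarrow> real" where
  "walk X n \<omega> = (\<Sum>i=1..n. X i \<omega>)"

definition passage_time :: "(nat \<Rightarrow> 'a \<Rightarrow> real) \<Rightarrow> real \<Rightarrow> 'a \<Rightarrow> enat" where
  "passage_time X b \<omega> = Inf {enat n | n. n \<ge> 1 \<and> walk X n \<omega> > b}"

text \<open>On the event that level \<open>b\<close> is never exceeded, the overshoot is set to \<open>0\<close>. That event is
  null whenever the increments have positive mean.\<close>

definition overshoot :: "(nat \<Rightarrow> 'a \<Rightarrow> real) \<Rightarrow> real \<Rightarrow> 'a \<Rightarrow> real" where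
  "overshoot X b \<omega> =
     (case passage_time X b \<omega> of enat n \<Rightarrow> walk X n \<omega> - b | \<infinity> \<Rightarrow> 0)"

end

theory Submission
  imports Defs
begin

text \<open>Almost surely the first increment equals \<open>c > 0\<close>, so the walk exceeds level
  0 at time 1 and the overshoot there is \<open>c\<close>. The left side is therefore
  \<open>c powr k\<close>. The mean is also \<open>c\<close>, so the right side is
  \<open>c powr (k + 1) / (k * c) = c powr k / k\<close>, which is strictly smaller because
  \<open>k > 1\<close>. The pointwise fact is \<open>overshoot_first_step\<close>;
  \<open>borel_measurable_overshoot\<close> supplies the measurability needed to replace the
  overshoot by \<open>c\<close> under the integral.\<close>

lemma Inf_enat_Collect:
  "Inf {enat n | n. P n} = (if \<exists>n. P n then enat (LEAST n. P n) else \<infinity>)"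
proof (cases "\<exists>n. P n")
  case True
  then have "P (LEAST n. P n)"
    by (rule LeastI_ex)
  then have "Inf {enat n | n. P n} = enat (LEAST n. P n)"
    by (intro antisym Inf_lower Inf_greatest) (auto intro: Least_le)
  with True show ?thesis
    by simp
next
  case False
  then show ?thesis
    by (simp add: top_enat_def)
qed

text \<open>Trades the infimum in \<open>enat\<close> for \<open>LEAST\<close> on
  \<open>nat\<close>, a form suited both to direct evaluation and to measurability proofs.\<close>

lemma overshoot_eq_Least:
  "overshoot X b \<omega> =
     (if \<exists>n. n \<ge> 1 \<and> walk X n \<omega> > b
      then walk X (LEAST n. n \<ge> 1 \<and> walk X n \<omega> > b) \<omega> - b else 0)"
  unfolding overshoot_def passage_time_def Inf_enat_Collect by auto

lemma overshoot_first_step: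
  assumes "X 1 \<omega> > b"
  shows "overshoot X b \<omega> = X 1 \<omega> - b"
proof -
  have "(LEAST n. n \<ge> 1 \<and> walk X n \<omega> > b) = 1"
    using assms by (intro Least_equality) (auto simp: walk_def)
  moreover have "\<exists>n. n \<ge> 1 \<and> walk X n \<omega> > b"
    using assms by (intro exI[of _ 1]) (simp add: walk_def)
  ultimately show ?thesis
    unfolding overshoot_eq_Least by (simp add: walk_def)
qed

lemma borel_measurable_overshoot:
  assumes "\<And>i. i \<ge> 1 \<Longrightarrow> X i \<in> borel_measurable M"
  shows "overshoot X b \<in> borel_measurable M"
proof -
  have [measurable]: "walk X n \<in> borel_measurable M" for n
    unfolding walk_def by (intro borel_measurable_sum assms) simp
  have [measurable]:
      "(\<lambda>\<omega>. LEAST n. n \<ge> 1 \<and> walk X n \<omega> > b) \<in> measurable M (count_space UNIV)"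
    by measurable
  \<comment> \<open>The walk is sampled at a random index; as the index takes countably many values,
    measurability of each \<open>walk X n\<close> suffices.\<close>
  have [measurable]:
      "(\<lambda>\<omega>. walk X (LEAST n. n \<ge> 1 \<and> walk X n \<omega> > b) \<omega>) \<in> borel_measurable M"
    by (rule measurable_compose_countable[where f = "walk X"]) measurable
  show ?thesis
    unfolding overshoot_eq_Least[abs_def] by measurable
qed

theorem proposition4:
  fixes M :: "'a measure" and X :: "nat \<Rightarrow> 'a \<Rightarrow> real" and c \<mu> k :: real
  assumes "prob_space M"
    and "iid M X"
    and "c > 0"
    and "AE \<omega> in M. X 1 \<omega> = c"
    and "\<mu> = (\<integral>\<omega>. X 1 \<omega> \<partial>M)"
    and "k > 1"
  shows "\<not> (\<integral>\<omega>. overshoot X 0 \<omega> powr k \<partial>M)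
           \<le> (\<integral>\<omega>. max (X 1 \<omega>) 0 powr (k + 1) \<partial>M) / (k * \<mu>)"
proof -
  interpret prob_space M by fact
  have X: "X i \<in> borel_measurable M" if "i \<ge> 1" for i
    using \<open>iid M X\<close> that unfolding iid_def indep_vars_def by auto
  note [measurable] = X[of 1, simplified] borel_measurable_overshoot[of X, OF X]
  have "(\<integral>\<omega>. X 1 \<omega> \<partial>M) = (\<integral>\<omega>. c \<partial>M)"
    using assms(4) by (intro integral_cong_AE) (auto simp: X)
  then have mean: "\<mu> = c"
    using assms(5) by (simp add: prob_space)
  have "(\<integral>\<omega>. max (X 1 \<omega>) 0 powr (k + 1) \<partial>M) = (\<integral>\<omega>. c powr (k + 1) \<partial>M)"
    using assms(3,4) by (intro integral_cong_AE) (auto elim!: eventually_mono)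
  \<comment> \<open>One factor \<open>c\<close> of \<open>c powr (k + 1)\<close> cancels against the
    mean.\<close>
  then have "(\<integral>\<omega>. max (X 1 \<omega>) 0 powr (k + 1) \<partial>M) / (k * \<mu>) = c powr k / k"
    using \<open>c > 0\<close> mean by (simp add: prob_space powr_add)
  moreover have "(\<integral>\<omega>. overshoot X 0 \<omega> powr k \<partial>M) = (\<integral>\<omega>. c powr k \<partial>M)"
  proof (rule integral_cong_AE)
    show "AE \<omega> in M. overshoot X 0 \<omega> powr k = c powr k"
      using assms(4)
    proof eventually_elim
      case (elim \<omega>)
      then show ?case
        using overshoot_first_step[of 0 X \<omega>] \<open>c > 0\<close> by simp
    qed
  qed measurable
  \<comment> \<open>Strict because \<open>c powr k\<close> is positive and
    \<open>k > 1\<close>.\<close>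
  moreover have "c powr k / k < c powr k"
    using \<open>c > 0\<close> \<open>k > 1\<close> by (simp add: divide_less_eq)
  ultimately show ?thesis
    by (simp add: prob_space)
qed

end
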